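(* Let $a$ and $b$ be relatively prime positive integers and $u$ and $v$ indeterminates. Let $\Delta\subseteq\mathbb{R}^2$ be the triangle with vertices $(0,0)$, $(a,0)$, and $(0,b)$. Then \[ (u-1) \, \sigma_\Delta (u,v) = u^a v \, \mathrm{c}\left( \tfrac{1}{u}, v; a, b \right) + u \left( u^a + v^b \right) - \frac{ v^{b+1} - 1 }{ v-1 } . \]
   Context: For a polytope $\mathcal{P}\subseteq\mathbb{R}^2$, its integer-point transform is $\sigma_{\mathcal{P}}(u,v) := \sum_{(m,n) \in \mathcal{P}\cap\mathbb{Z}^2} u^m v^n$. For positive integers $a,b$ and indeterminates $u,v$, the Dedekind--Carlitz polynomial is $\mathrm{c}(u,v;a,b) := \sum_{k=1}^{b-1} u^{\lfloor ka/b\rfloor} v^{k-1}$, so that $\mathrm{c}(1/u, v; a,b) = \sum_{k=1}^{b-1} u^{-\lfloor ka/b\rfloor} v^{k-1}$. *)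

theory Defs
  imports "HOL-Analysis.Analysis" "HOL-Computational_Algebra.Computational_Algebra"
begin

text \<open>The sum is meaningful for bounded \<open>P\<close>, in particular for polytopes; for a set with
  infinitely many lattice points it is \<open>0\<close> by convention.\<close>

definition integer_point_transform :: "(real \<times> real) set \<Rightarrow> 'k::field \<Rightarrow> 'k \<Rightarrow> 'k" where
  "integer_point_transform P u v =
     (\<Sum>(m, n) \<in> {(m, n). (real_of_int m, real_of_int n) \<in> P}. u powi m * v powi n)"

definition dedekind_carlitz :: "'k::field \<Rightarrow> 'k \<Rightarrow> nat \<Rightarrow> nat \<Rightarrow> 'k" where
  "dedekind_carlitz u v a b =
     (\<Sum>k = 1..b - 1. u powi \<lfloor>real k * real a / real b\<rfloor> * v ^ (k - 1))"

text \<open>The two indeterminates of the field of rational functions in two variables over (the fraction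
  field of) an integral domain \<open>R\<close>, realised as the fraction field of \<open>R[u][v]\<close>.\<close>

definition indet_u :: "'r::idom poly poly fract" where
  "indet_u = Fract [:[:0, 1:]:] 1"

definition indet_v :: "'r::idom poly poly fract" where
  "indet_v = Fract [:0, 1:] 1"

end

theory Submission
  imports Defs
begin

text \<open>Slice the triangle horizontally. The row at height \<open>n\<close> consists of the points with
  \<open>0 \<le> m \<le> \<lfloor>a - na/b\<rfloor>\<close>, so multiplying its transform by \<open>u - 1\<close> telescopes to
  \<open>v\<^sup>n (u\<^bsup>\<lfloor>a - na/b\<rfloor> + 1\<^esup> - 1)\<close>. The terms \<open>- v\<^sup>n\<close> add up to the geometric series, the rows \<open>n = 0\<close>
  and \<open>n = b\<close> give \<open>u (u\<^sup>a + v\<^sup>b)\<close>, and for \<open>0 < n < b\<close> coprimality makes \<open>na/b\<close> a non-integer, so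
  that \<open>\<lfloor>a - na/b\<rfloor> + 1 = a - \<lfloor>na/b\<rfloor>\<close>.\<close>

text \<open>The barycentric coordinates of \<open>(x, y)\<close> are
  \<open>1 - x / a - y / b\<close>, \<open>x / a\<close> and \<open>y / b\<close>; the right-hand
  side says that they are nonnegative, with denominators cleared.\<close>

lemma mem_convex_hull_axis_triangle:
  fixes a b x y :: real
  assumes "a > 0" "b > 0"
  shows "(x, y) \<in> convex hull {(0, 0), (a, 0), (0, b)} \<longleftrightarrow> 0 \<le> x \<and> 0 \<le> y \<and> x * b + y * a \<le> a * b"
    (is "?L \<longleftrightarrow> ?R")
proof
  assume ?L
  then obtain s t w where *: "0 \<le> s" "0 \<le> t" "0 \<le> w" "s + t + w = 1" "x = t * a" "y = w * b"
    unfolding convex_hull_3 by auto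
  have "(t + w) * (a * b) \<le> 1 * (a * b)"
    using * assms by (intro mult_right_mono) auto
  then show ?R
    using * assms by (auto simp: algebra_simps)
next
  assume R: ?R
  have "x / a + y / b \<le> 1"
    using R assms by (simp add: field_simps)
  then show ?L
    unfolding convex_hull_3 mem_Collect_eq
    using R assms
    by (intro exI[of _ "1 - x / a - y / b"] exI[of _ "x / a"] exI[of _ "y / b"]) auto
qed

text \<open>Indexing by (height, column), the reverse of the coordinate order, makes the set a
  \<open>SIGMA\<close> over the heights, so that a sum over it splits into rows.\<close>

lemma lattice_points_axis_triangle:
  fixes a b :: nat
  assumes "a > 0" "b > 0"
  shows "{(m, n). (real_of_int m, real_of_int n) \<in> convex hull {(0, 0), (real a, 0), (0, real b)}} =
    (\<lambda>(n, m). (int m, int n)) ` (SIGMA n:{..b}. {..a * (b - n) div b})" (is "?A = ?B")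
proof -
  \<comment> \<open>Subtraction truncates: for \<open>n > b\<close> the bound on \<open>m\<close> is
    \<open>0\<close>, which still admits \<open>m = 0\<close>, so the conjunct
    \<open>n \<le> b\<close> excludes these heights.\<close>
  have row: "n \<le> b \<and> m \<le> a * (b - n) div b \<longleftrightarrow> m * b + n * a \<le> a * b" for m n :: nat
  proof (cases "n \<le> b")
    case True
    then have "n * a \<le> a * b"
      by (simp add: mult.commute)
    moreover have "m \<le> a * (b - n) div b \<longleftrightarrow> m * b \<le> a * b - n * a"
      using assms by (simp add: less_eq_div_iff_mult_less_eq diff_mult_distrib2 mult.commute[of n])
    ultimately show ?thesis
      using True by linarith
  next
    case False
    then have "a * b < n * a"
      using assms by simp
    then have "\<not> m * b + n * a \<le> a * b"
      by linarith
    then show ?thesis using False by blast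
  qed
  have real_row: "(real m * real b + real n * real a \<le> real a * real b) \<longleftrightarrow> m * b + n * a \<le> a * b"
    for m n :: nat
    by (simp only: of_nat_mult[symmetric] of_nat_add[symmetric] of_nat_le_iff)
  have "(m, n) \<in> ?A \<longleftrightarrow> (m, n) \<in> ?B" for m n :: int
  proof -
    have "(m, n) \<in> ?A \<longleftrightarrow> 0 \<le> m \<and> 0 \<le> n \<and>
        real_of_int m * real b + real_of_int n * real a \<le> real a * real b"
      using assms by (simp add: mem_convex_hull_axis_triangle)
    also have "\<dots> \<longleftrightarrow> (\<exists>i j. m = int i \<and> n = int j \<and> i * b + j * a \<le> a * b)"
    proof
      assume R: "0 \<le> m \<and> 0 \<le> n \<and> real_of_int m * real b + real_of_int n * real a \<le> real a * real b"
      then obtain i j where "m = int i" "n = int j"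
        by (meson nonneg_int_cases)
      then show "\<exists>i j. m = int i \<and> n = int j \<and> i * b + j * a \<le> a * b"
        using R real_row[of i j] by auto
    next
      assume "\<exists>i j. m = int i \<and> n = int j \<and> i * b + j * a \<le> a * b"
      then show "0 \<le> m \<and> 0 \<le> n \<and> real_of_int m * real b + real_of_int n * real a \<le> real a * real b"
        using real_row by auto
    qed
    also have "\<dots> \<longleftrightarrow> (m, n) \<in> ?B"
      by (auto simp: row[symmetric] image_iff)
    finally show ?thesis .
  qed
  then show ?thesis by auto
qed

lemma integer_point_transform_axis_triangle:
  fixes u v :: "'k::field"
  assumes "a > 0" "b > 0"
  shows "integer_point_transform (convex hull {(0, 0), (real a, 0), (0, real b)}) u v =
    (\<Sum>n\<le>b. v ^ n * (\<Sum>m\<le>a * (b - n) div b. u ^ m))"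
proof -
  have inj: "inj_on (\<lambda>(n, m). (int m, int n)) X" for X
    by (auto simp: inj_on_def)
  show ?thesis
    unfolding integer_point_transform_def lattice_points_axis_triangle[OF assms]
    by (subst sum.reindex[OF inj])
      (simp add: o_def case_prod_unfold sum.Sigma sum_distrib_left mult.commute)
qed

text \<open>If \<open>n * a = q * b + r\<close> with \<open>0 < r < b\<close>, then
  \<open>a * (b - n) = (a - q - 1) * b + (b - r)\<close> and \<open>0 < b - r < b\<close>. The
  additive form avoids truncated subtraction.\<close>

lemma div_add_div_complement:
  fixes a b n :: nat
  assumes "0 < n" "n < b" "coprime a b"
  shows "Suc (a * (b - n) div b) + n * a div b = a"
proof -
  \<comment> \<open>By coprimality \<open>b\<close> would divide \<open>n\<close>, but
    \<open>0 < n < b\<close>.\<close>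
  have "\<not> b dvd n * a"
    using assms by (metis coprime_commute coprime_dvd_mult_left_iff nat_dvd_not_less)
  then have pos: "0 < n * a mod b"
    by (simp add: mod_greater_zero_iff_not_dvd)
  define q r where "q = n * a div b" and "r = n * a mod b"
  have na: "n * a = q * b + r" and r: "0 < r" "r < b"
    using pos assms by (simp_all add: q_def r_def)
  have "q * b < a * b"
  proof -
    have "n * a \<le> a * b" using assms by simp
    then show ?thesis using na r by linarith
  qed
  then have "q < a" by simp
  then obtain p where p: "a = Suc (q + p)"
    using less_imp_Suc_add by blast
  have "a * (b - n) = a * b - n * a"
    by (simp add: diff_mult_distrib2 mult.commute)
  also have "\<dots> = p * b + (b - r)"
    using na r p by (simp add: algebra_simps)
  finally have "a * (b - n) div b = p"
    using r by (intro div_nat_eqI) (auto simp: mult.commute)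
  then have "Suc (a * (b - n) div b) + q = a"
    using p by linarith
  then show ?thesis
    unfolding q_def .
qed

text \<open>The identity holds for elements of any field: \<open>u \<noteq> 0\<close> lets the
  powers of \<open>1 / u\<close> cancel, and \<open>v \<noteq> 1\<close> allows the geometric sum.
  The indeterminates are a special case.\<close>

lemma transform_axis_triangle_dedekind_carlitz:
  fixes u v :: "'k::field"
  assumes "a > 0" "b > 0" "coprime a b" "u \<noteq> 0" "v \<noteq> 1"
  shows "(u - 1) * integer_point_transform (convex hull {(0, 0), (real a, 0), (0, real b)}) u v =
    u ^ a * v * dedekind_carlitz (1 / u) v a b + u * (u ^ a + v ^ b) - (v ^ (b + 1) - 1) / (v - 1)"
proof -
  \<comment> \<open>\<open>M n\<close> counts the lattice points at height
    \<open>n \<le> b\<close>.\<close>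
  define M where "M n = Suc (a * (b - n) div b)" for n
  have "(u - 1) * integer_point_transform (convex hull {(0, 0), (real a, 0), (0, real b)}) u v =
      (\<Sum>n\<le>b. v ^ n * ((u - 1) * (\<Sum>m<M n. u ^ m)))"
    using assms
    by (simp add: integer_point_transform_axis_triangle sum_distrib_left M_def lessThan_Suc_atMost
        mult.left_commute)
  also have "\<dots> = (\<Sum>n\<le>b. v ^ n * (u ^ M n - 1))"
    by (simp only: power_diff_1_eq)
  also have "\<dots> = (\<Sum>n\<le>b. v ^ n * u ^ M n) - (\<Sum>n<b + 1. v ^ n)"
    by (simp add: algebra_simps sum_subtractf lessThan_Suc_atMost)
  also have "(\<Sum>n<b + 1. v ^ n) = (v ^ (b + 1) - 1) / (v - 1)"
    using assms by (intro geometric_sum)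
  also have "(\<Sum>n\<le>b. v ^ n * u ^ M n) = (\<Sum>n = 1..b - 1. v ^ n * u ^ M n) + u * (u ^ a + v ^ b)"
  proof -
    \<comment> \<open>The two end rows have \<open>M 0 = a + 1\<close> and \<open>M b = 1\<close>;
      they are distinct as \<open>b > 0\<close>.\<close>
    have "{..b} = insert 0 (insert b {1..b - 1})"
      using assms by auto
    then show ?thesis
      using assms by (simp add: M_def algebra_simps)
  qed
  also have "(\<Sum>n = 1..b - 1. v ^ n * u ^ M n) = u ^ a * v * dedekind_carlitz (1 / u) v a b"
    unfolding dedekind_carlitz_def sum_distrib_left
  proof (rule sum.cong[OF refl])
    fix n assume n: "n \<in> {1..b - 1}"
    then have "M n + n * a div b = a"
      using assms div_add_div_complement[of n b a] by (auto simp: M_def)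
    then have "u ^ a = u ^ M n * u ^ (n * a div b)"
      by (metis power_add)
    moreover have "\<lfloor>real n * real a / real b\<rfloor> = int (n * a div b)"
      by (metis floor_divide_of_nat_eq of_nat_mult)
    \<comment> \<open>Since \<open>n \<ge> 1\<close>, the exponent \<open>n - 1\<close> is not
      truncated; the split-off \<open>v\<close> is the prefactor of the Dedekind-Carlitz
      polynomial.\<close>
    moreover have "v ^ n = v * v ^ (n - 1)"
      using n by (cases n) auto
    ultimately show "v ^ n * u ^ M n =
        u ^ a * v * ((1 / u) powi \<lfloor>real n * real a / real b\<rfloor> * v ^ (n - 1))"
      using assms by (simp add: power_one_over)
  qed
  finally show ?thesis by simp
qed

lemma indet_u_neq_0: "(indet_u :: 'r::idom poly poly fract) \<noteq> 0"
  by (simp add: indet_u_def Zero_fract_def eq_fract)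

lemma indet_v_neq_1: "(indet_v :: 'r::idom poly poly fract) \<noteq> 1"
  by (simp add: indet_v_def One_fract_def eq_fract one_pCons)

theorem theorem13:
  fixes a b :: nat
    and u v :: "'r::idom poly poly fract"
    and \<Delta> :: "(real \<times> real) set"
  assumes "a > 0" and "b > 0" and "coprime a b"
    and "u = indet_u" and "v = indet_v"
    and "\<Delta> = convex hull {(0, 0), (real a, 0), (0, real b)}"
  shows "(u - 1) * integer_point_transform \<Delta> u v =
           u ^ a * v * dedekind_carlitz (1 / u) v a b + u * (u ^ a + v ^ b)
             - (v ^ (b + 1) - 1) / (v - 1)"
  unfolding assms(4-6)
  using assms(1-3) indet_u_neq_0 indet_v_neq_1 by (rule transform_axis_triangle_dedekind_carlitz)

end
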